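(* Let $U$ be a bi-potential matrix and let $f:\mathbb{R}_+\to\mathbb{R}_+$ be a strictly increasing convex function. Then $f(U)$ is a bi-potential if and only if $f(U)$ belongs to class $\mathcal{T}$.
   Context: All matrices are real and square; inequalities are entrywise; $'$ denotes transpose; $\mathbb{I}$ is the identity matrix, $\mathbf 1$ the vector of ones, $\mathbb{R}_+=[0,\infty)$. $f(U)$ is the matrix with entries $f(U_{ij})$. A nonnegative matrix $V$ is a bi-potential if it is nonsingular and $(V^{-1})_{ij}\le 0$ for $i\neq j$, $(V^{-1})_{ii}>0$, $\sum_j (V^{-1})_{ij}\ge 0$ for every $i$, and $\sum_i (V^{-1})_{ij}\ge 0$ for every $j$. For a nonnegative matrix $V$, $\tau(V)=\inf\{t\ge 0:\ \mathbb{I}+tV \text{ is not a bi-potential}\}$, with $\inf\emptyset=\infty$. A nonnegative matrix $V$ is in class $\mathcal{T}$ if $$\tau(V)=\inf\{t>0:\ (\mathbb{I}+tV)^{-1}\mathbf 1\not\ge 0\ \text{ or }\ \mathbf 1'(\mathbb{I}+tV)^{-1}\not\ge 0\}$$ (the set being over those $t>0$ for which $\mathbb{I}+tV$ is nonsingular; $\not\ge 0$ means that some component is negative), and $\mathbb{I}+\tau(V)V$ is nonsingular whenever $\tau(V)<\infty$. *)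

theory Defs
  imports "HOL-Analysis.Analysis" "HOL-Library.Extended_Real"
begin

text \<open>Square matrices of arbitrary size are elements of \<open>real^'n^'n\<close>, with \<open>V $ i $ j\<close> the
  entry in row \<open>i\<close> and column \<open>j\<close>. Since \<open>matrix_inv\<close> is unspecified on singular matrices, it is
  used below only together with \<open>invertible\<close>.\<close>

definition nonneg_matrix :: "real^'n^'n \<Rightarrow> bool" where
  "nonneg_matrix V \<longleftrightarrow> (\<forall>i j. 0 \<le> V $ i $ j)"

definition bi_potential :: "real^'n^'n \<Rightarrow> bool" where
  "bi_potential V \<longleftrightarrow>
     nonneg_matrix V \<and> invertible V \<and>
     (\<forall>i j. i \<noteq> j \<longrightarrow> matrix_inv V $ i $ j \<le> 0) \<and>
     (\<forall>i. matrix_inv V $ i $ i > 0) \<and>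
     (\<forall>i. (\<Sum>j\<in>UNIV. matrix_inv V $ i $ j) \<ge> 0) \<and>
     (\<forall>j. (\<Sum>i\<in>UNIV. matrix_inv V $ i $ j) \<ge> 0)"

text \<open>The infima are taken in \<^typ>\<open>ereal\<close>, where the infimum of the empty set is \<open>\<infinity>\<close>.\<close>

definition tau :: "real^'n^'n \<Rightarrow> ereal" where
  "tau V = Inf {ereal t | t. t \<ge> 0 \<and> \<not> bi_potential (mat 1 + t *\<^sub>R V)}"

definition ones :: "real^'n" where
  "ones = (\<chi> i. 1)"

definition class_T :: "real^'n^'n \<Rightarrow> bool" where
  "class_T V \<longleftrightarrow>
     nonneg_matrix V \<and>
     tau V = Inf {ereal t | t. t > 0 \<and> invertible (mat 1 + t *\<^sub>R V) \<and>
                   ((\<exists>i. (matrix_inv (mat 1 + t *\<^sub>R V) *v ones) $ i < 0) \<or>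
                    (\<exists>j. (ones v* matrix_inv (mat 1 + t *\<^sub>R V)) $ j < 0))} \<and>
     (tau V < \<infinity> \<longrightarrow> invertible (mat 1 + real_of_ereal (tau V) *\<^sub>R V))"

definition map_entries :: "(real \<Rightarrow> real) \<Rightarrow> real^'n^'n \<Rightarrow> real^'n^'n" where
  "map_entries f U = (\<chi> i j. f (U $ i $ j))"

end

theory Submission
  imports Defs
begin

text \<open>
  Write \<open>M = U\<inverse>\<close>. Each row of \<open>M\<close> exhibits \<open>U $ i $ j\<close> as a sub-convex combination of the
  other entries of column \<open>j\<close> of \<open>U\<close>, so for convex \<open>f\<close> with \<open>f 0 = 0\<close> the matrix \<open>A = M f(U)\<close> has
  nonpositive off-diagonal entries. Its column sums are positive, and hence so are those of
  \<open>t A + r M\<close>, for which \<open>r \<I> + t f(U) = U (t A + r M)\<close>. Therefore this matrix has a nonnegative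
  inverse, and \<open>(r \<I> + t f(U))\<inverse> \<one> = (t A + r M)\<inverse> (M \<one>) \<ge> 0\<close>. A positive value \<open>f 0\<close> is a
  rank one perturbation, and the left-hand version follows by transposition. So \<open>f(U)\<close> is always
  nonsingular and the second infimum in the definition of class \<open>\<T>\<close> is always \<open>\<infinity>\<close>; it remains to
  see that a nonsingular nonnegative \<open>V\<close> is a bi-potential iff \<open>\<tau>(V) = \<infinity>\<close>, where one direction
  lets \<open>t\<close> tend to infinity in \<open>t (\<I> + t V)\<inverse>\<close>.
\<close>

section \<open>Inverses, transposes and a criterion for bi-potentials\<close>

lemma matrix_inv_eq:
  fixes A B :: "real^'n^'n"
  assumes "A ** B = mat 1"
  shows "matrix_inv A = B"
proof -
  have BA: "B ** A = mat 1"
    using assms by (simp add: matrix_left_right_inverse)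
  have "A ** matrix_inv A = mat 1"
    unfolding matrix_inv_def by (rule someI2[of _ B]) (use assms BA in auto)
  then have "B ** (A ** matrix_inv A) = B"
    by simp
  then show ?thesis
    by (simp add: matrix_mul_assoc BA)
qed

lemma invertible_obtain:
  fixes A :: "real^'n^'n"
  assumes "invertible A"
  obtains B where "A ** B = mat 1" "B ** A = mat 1" "matrix_inv A = B"
  using assms matrix_inv_eq unfolding invertible_def by blast

lemma matrix_inv_transpose:
  fixes A :: "real^'n^'n"
  assumes "invertible A"
  shows "matrix_inv (transpose A) = transpose (matrix_inv A)"
proof -
  obtain B where "B ** A = mat 1" "matrix_inv A = B"
    using assms by (rule invertible_obtain)
  then show ?thesis
    by (metis matrix_inv_eq matrix_transpose_mul transpose_mat)
qed

lemma matrix_add_rdistrib: "(A + B) ** C = A ** C + B ** C"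
  by (simp add: matrix_matrix_mult_def vec_eq_iff distrib_right sum.distrib)

text \<open>A nonpositive diagonal entry of \<open>M\<close> would make its whole row nonpositive,
  and against the nonnegative \<open>V\<close> the same diagonal entry of \<open>M ** V\<close>
  would be nonpositive instead of 1.\<close>

lemma bi_potential_iff:
  fixes V M :: "real^'n^'n"
  assumes VM: "V ** M = mat 1"
  shows "bi_potential V \<longleftrightarrow> nonneg_matrix V \<and> (\<forall>i j. i \<noteq> j \<longrightarrow> M $ i $ j \<le> 0) \<and>
    0 \<le> M *v ones \<and> 0 \<le> ones v* M"
proof -
  have inv: "matrix_inv V = M" and "invertible V"
    using VM by (auto simp: matrix_inv_eq invertible_right_inverse)
  have "M $ i $ i > 0" if V: "nonneg_matrix V" and M: "\<forall>i j. i \<noteq> j \<longrightarrow> M $ i $ j \<le> 0" for i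
  proof (rule ccontr)
    assume "\<not> M $ i $ i > 0"
    then have "M $ i $ j \<le> 0" for j
      using M by (cases "i = j") auto
    then have "(M ** V) $ i $ i \<le> 0"
      using V by (auto simp: matrix_matrix_mult_def nonneg_matrix_def
          intro!: sum_nonpos mult_nonpos_nonneg)
    moreover have "M ** V = mat 1"
      using VM by (simp add: matrix_left_right_inverse)
    ultimately show False
      by (simp add: mat_def)
  qed
  then show ?thesis
    unfolding bi_potential_def inv using \<open>invertible V\<close>
    by (auto simp: less_eq_vec_def matrix_vector_mult_def vector_matrix_mult_def ones_def)
qed

lemma bi_potential_obtain:
  fixes V :: "real^'n^'n"
  assumes "bi_potential V"
  obtains M where "V ** M = mat 1" "M ** V = mat 1" "\<And>i j. i \<noteq> j \<Longrightarrow> M $ i $ j \<le> 0"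
    "0 \<le> M *v ones" "0 \<le> ones v* M" "\<And>i j. 0 \<le> V $ i $ j"
proof -
  have "invertible V"
    using assms by (simp add: bi_potential_def)
  then obtain M where "V ** M = mat 1" "M ** V = mat 1"
    by (rule invertible_obtain)
  with that bi_potential_iff[of V M] assms show thesis
    by (auto simp: nonneg_matrix_def)
qed

lemma bi_potential_transpose:
  fixes V :: "real^'n^'n"
  assumes "bi_potential V"
  shows "bi_potential (transpose V)"
proof -
  obtain M where M: "V ** M = mat 1" "M ** V = mat 1" "\<And>i j. i \<noteq> j \<Longrightarrow> M $ i $ j \<le> 0"
    "0 \<le> M *v ones" "0 \<le> ones v* M" "\<And>i j. 0 \<le> V $ i $ j"
    using assms by (rule bi_potential_obtain) blast
  have "transpose V ** transpose M = mat 1"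
    by (metis M(2) matrix_transpose_mul transpose_mat)
  from bi_potential_iff[OF this] M show ?thesis
    by (simp add: nonneg_matrix_def) (simp add: transpose_def)
qed

subsection \<open>Matrices with nonpositive off-diagonal entries\<close>

text \<open>Sum \<open>(B *v x) $ i\<close> over the set \<open>S\<close> of indices with \<open>x $ i < 0\<close>.\<close>

lemma Z_matrix_monotone:
  fixes B :: "real^'n^'n"
  assumes off: "\<And>i j. i \<noteq> j \<Longrightarrow> B $ i $ j \<le> 0"
    and col: "\<And>j. (ones v* B) $ j > 0"
    and Bx: "0 \<le> B *v x"
  shows "0 \<le> x"
proof (rule ccontr)
  define S where "S = {i. x $ i < 0}"
  define c where "c j = (\<Sum>i\<in>S. B $ i $ j)" for j
  assume "\<not> 0 \<le> x"
  then obtain k where k: "k \<in> S"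
    by (auto simp: less_eq_vec_def S_def not_le)
  \<comment> \<open>For \<open>j\<close> in \<open>S\<close> the rows outside \<open>S\<close>
    contribute only nonpositive off-diagonal entries, so \<open>c j\<close> is at least the full
    column sum. For \<open>j\<close> outside \<open>S\<close> all terms of \<open>c j\<close> are
    off-diagonal.\<close>
  have pos: "c j > 0" if "j \<in> S" for j
  proof -
    have "(\<Sum>i\<in>UNIV. B $ i $ j) \<le> c j"
      unfolding c_def by (rule sum_mono2[of UNIV S "\<lambda>i. - B $ i $ j", unfolded sum_negf, simplified])
        (use off that in \<open>auto intro!: off\<close>)
    then show ?thesis
      using col[of j] by (simp add: vector_matrix_mult_def ones_def)
  qed
  have neg: "c j \<le> 0" if "j \<notin> S" for j
    unfolding c_def using that by (auto intro!: sum_nonpos off)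
  have le: "c j * x $ j \<le> 0" for j
    using pos[of j] neg[of j] by (cases "j \<in> S") (auto simp: S_def mult_le_0_iff)
  have lt: "c k * x $ k < 0"
    using pos[OF k] k by (simp add: S_def mult_pos_neg)
  have "0 \<le> (\<Sum>i\<in>S. (B *v x) $ i)"
    using Bx by (auto simp: less_eq_vec_def intro!: sum_nonneg)
  also have "\<dots> = (\<Sum>j\<in>UNIV. c j * x $ j)"
    unfolding matrix_vector_mult_def c_def
    by (simp add: sum_distrib_right) (rule sum.swap)
  also have "\<dots> < 0"
    using sum_strict_mono_ex1[of UNIV "\<lambda>j. c j * x $ j" "\<lambda>_. 0"] le lt by auto
  finally show False
    by simp
qed

text \<open>Monotonicity applied to both \<open>x\<close> and \<open>- x\<close> makes the kernel of
  \<open>B\<close> trivial. Applied to \<open>C *v y\<close>, which \<open>B\<close> maps to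
  \<open>y\<close>, it makes \<open>C\<close> preserve nonnegative vectors, in particular the basis
  vectors.\<close>

lemma Z_matrix_inverse:
  fixes B :: "real^'n^'n"
  assumes off: "\<And>i j. i \<noteq> j \<Longrightarrow> B $ i $ j \<le> 0"
    and col: "\<And>j. (ones v* B) $ j > 0"
  obtains C where "B ** C = mat 1" "C ** B = mat 1" "\<And>i j. 0 \<le> C $ i $ j" "\<And>y. 0 \<le> y \<Longrightarrow> 0 \<le> C *v y"
proof -
  note mono = Z_matrix_monotone[OF off col]
  have "x = 0" if "B *v x = 0" for x
  proof (rule antisym)
    have "B *v (- x) = 0"
      using that by (metis diff_0 diff_zero matrix_vector_mult_0_right matrix_vector_mult_diff_distrib)
    then have "0 \<le> - x"
      using mono[of "- x"] by simp
    then show "x \<le> 0"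
      by (auto simp: less_eq_vec_def)
    show "0 \<le> x"
      using that mono[of x] by simp
  qed
  then have "\<exists>C. C ** B = mat 1"
    using matrix_left_invertible_ker[of B] by blast
  then obtain C where C: "C ** B = mat 1" "B ** C = mat 1"
    using matrix_left_right_inverse by blast
  have nn: "0 \<le> C *v y" if "0 \<le> y" for y
    by (rule mono) (use that in \<open>auto simp: matrix_vector_mul_assoc C\<close>)
  have "0 \<le> C $ i $ j" for i j
  proof -
    have "0 \<le> C *v axis j 1"
      by (rule nn) (auto simp: less_eq_vec_def axis_def)
    then show ?thesis
      by (simp add: less_eq_vec_def matrix_vector_mult_basis column_def)
  qed
  with that C nn show thesis
    by blast
qed

subsection \<open>Bi-potentials and \<open>\<tau>\<close>\<close>

text \<open>If \<open>M\<close> is the inverse of \<open>V\<close>, then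
  \<open>mat 1 + t *\<^sub>R V = V ** (M + t *\<^sub>R mat 1)\<close>, and for \<open>t > 0\<close>
  the shift makes the column sums of the second factor strictly positive. With \<open>C\<close> the
  inverse of that factor, the inverse sought is \<open>C ** M = mat 1 - t *\<^sub>R C\<close>, so
  its off-diagonal signs come from \<open>C\<close> being nonnegative.\<close>

lemma bi_potential_mat1_add:
  fixes V :: "real^'n^'n"
  assumes "bi_potential V" and "0 \<le> t"
  shows "bi_potential (mat 1 + t *\<^sub>R V)"
proof (cases "t = 0")
  case True
  have "bi_potential (mat 1 :: real^'n^'n)"
    using bi_potential_iff[of "mat 1 :: real^'n^'n" "mat 1"]
    by (simp add: nonneg_matrix_def less_eq_vec_def ones_def) (simp add: mat_def)
  with True show ?thesis
    by simp
next
  case False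
  with assms(2) have t: "0 < t"
    by simp
  obtain M where M: "V ** M = mat 1" "M ** V = mat 1" "\<And>i j. i \<noteq> j \<Longrightarrow> M $ i $ j \<le> 0"
    "0 \<le> M *v ones" "0 \<le> ones v* M" and V: "\<And>i j. 0 \<le> V $ i $ j"
    using assms(1) by (rule bi_potential_obtain) blast
  let ?B = "M + t *\<^sub>R mat 1"
  have off: "?B $ i $ j \<le> 0" if "i \<noteq> j" for i j
    using M(3)[OF that] that by (simp add: mat_def)
  have col: "(ones v* ?B) $ j > 0" for j
    using M(5) t by (auto simp: vector_matrix_mult_add_rdistrib vector_scaleR_matrix_ac less_eq_vec_def
        ones_def intro!: add_nonneg_pos)
  obtain C where C: "?B ** C = mat 1" "C ** ?B = mat 1" "\<And>i j. 0 \<le> C $ i $ j"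
      "\<And>y. 0 \<le> y \<Longrightarrow> 0 \<le> C *v y"
    using Z_matrix_inverse[of ?B, OF off col] by blast
  have CM: "C ** M + t *\<^sub>R C = mat 1"
    using C(2) by (simp add: matrix_add_ldistrib matrix_scalar_ac)
  have MC: "M ** C + t *\<^sub>R C = mat 1"
    using C(1) by (simp add: matrix_add_rdistrib flip: scalar_matrix_assoc)
  \<comment> \<open>The order \<open>C ** M\<close> suits the row sums; the order
    \<open>M ** C\<close> lets \<open>ones v* M\<close> appear first in the column sums.\<close>
  have eq: "C ** M = M ** C"
    using CM MC by (metis add_right_cancel)
  have "mat 1 + t *\<^sub>R V = V ** ?B"
    by (simp add: matrix_add_ldistrib matrix_scalar_ac M)
  then have inv: "(mat 1 + t *\<^sub>R V) ** (C ** M) = mat 1"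
    by (metis C(1) M(1) matrix_mul_assoc matrix_mul_rid)
  show ?thesis
    unfolding bi_potential_iff[OF inv]
  proof (intro conjI allI impI)
    show "nonneg_matrix (mat 1 + t *\<^sub>R V)"
      using V t by (auto simp: nonneg_matrix_def mat_def)
    fix i j :: 'n
    assume "i \<noteq> j"
    have "(C ** M) $ i $ j + t * C $ i $ j = (mat 1 :: real^'n^'n) $ i $ j"
      by (simp flip: CM)
    moreover have "0 \<le> t * C $ i $ j"
      using t C(3) by simp
    ultimately show "(C ** M) $ i $ j \<le> 0"
      using \<open>i \<noteq> j\<close> by (simp add: mat_def)
  next
    show "0 \<le> (C ** M) *v ones"
      using C(4)[OF M(4)] by (simp add: matrix_vector_mul_assoc)
    have "0 \<le> (ones v* M) v* C"
      using M(5) C(3) by (auto simp: vector_matrix_mult_def[of "ones v* M"] less_eq_vec_def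
          intro!: sum_nonneg)
    then show "0 \<le> ones v* (C ** M)"
      by (simp add: eq vector_matrix_mul_assoc)
  qed
qed

text \<open>Applying \<open>M\<close> to the equation gives
  \<open>t *\<^sub>R (x t - M *v y) = - (M *v x t)\<close>, so the error is of order
  \<open>1 / t\<close>.\<close>

lemma resolvent_tendsto:
  fixes V M :: "real^'n^'n" and x :: "real \<Rightarrow> real^'n"
  assumes MV: "M ** V = mat 1"
    and x: "\<And>t. t > 0 \<Longrightarrow> x t + t *\<^sub>R (V *v x t) = t *\<^sub>R y"
  shows "(x \<longlongrightarrow> M *v y) at_top"
proof -
  obtain K where K: "K > 0" "\<And>z. norm (M *v z) \<le> norm z * K"
    using bounded_linear.pos_bounded[OF matrix_vector_mul_bounded_linear[of M]] by blast
  \<comment> \<open>From \<open>t >= 2 * K\<close> on, the error term on the right is at most half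
    of the left-hand side and can be absorbed.\<close>
  have bound: "norm (x t - M *v y) \<le> 2 * K * norm (M *v y) / t" if t: "t \<ge> 2 * K" for t
  proof -
    have t0: "t > 0"
      using t K(1) by linarith
    have "M *v (x t + t *\<^sub>R (V *v x t)) = t *\<^sub>R (M *v y)"
      using x[OF t0] by (simp add: matrix_vector_mult_scaleR)
    then have "M *v x t + t *\<^sub>R x t = t *\<^sub>R (M *v y)"
      by (simp add: matrix_vector_right_distrib matrix_vector_mult_scaleR matrix_vector_mul_assoc MV)
    then have "t *\<^sub>R (x t - M *v y) = - (M *v x t)"
      by (simp add: algebra_simps)
    then have "t * norm (x t - M *v y) = norm (M *v x t)"
      using t0 by (metis abs_of_pos norm_minus_cancel norm_scaleR)
    then have le: "t * norm (x t - M *v y) \<le> K * norm (x t)"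
      using K(2)[of "x t"] by (simp add: mult.commute)
    also have "\<dots> \<le> K * norm (x t - M *v y) + K * norm (M *v y)"
      using norm_triangle_sub[of "x t" "M *v y"] K(1) by (simp flip: distrib_left)
    also have "K * norm (x t - M *v y) \<le> t / 2 * norm (x t - M *v y)"
      using t by (intro mult_right_mono) auto
    finally show ?thesis
      using t0 by (simp add: field_simps)
  qed
  have "((\<lambda>t. x t - M *v y) \<longlongrightarrow> 0) at_top"
  proof (rule Lim_null_comparison)
    show "\<forall>\<^sub>F t in at_top. norm (x t - M *v y) \<le> 2 * K * norm (M *v y) / t"
      using eventually_ge_at_top[of "2 * K"] by eventually_elim (rule bound)
    show "((\<lambda>t. 2 * K * norm (M *v y) / t) \<longlongrightarrow> 0) at_top"
      by (intro tendsto_divide_0[OF tendsto_const] filterlim_at_top_imp_at_infinity filterlim_ident)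
  qed
  then show ?thesis
    by (simp add: LIM_zero_iff)
qed

lemma bi_potential_limit:
  fixes V :: "real^'n^'n"
  assumes V: "nonneg_matrix V" "invertible V"
    and bp: "\<And>t. t > 0 \<Longrightarrow> bi_potential (mat 1 + t *\<^sub>R V)"
  shows "bi_potential V"
proof -
  obtain M where M: "V ** M = mat 1" "M ** V = mat 1"
    using V(2) by (rule invertible_obtain)
  define N where "N t = matrix_inv (mat 1 + t *\<^sub>R V)" for t
  have N: "(mat 1 + t *\<^sub>R V) ** N t = mat 1" "N t ** (mat 1 + t *\<^sub>R V) = mat 1" if "t > 0" for t
    unfolding N_def using bp[OF that] by (auto simp: bi_potential_def elim: invertible_obtain)
  have N': "\<And>i j. i \<noteq> j \<Longrightarrow> N t $ i $ j \<le> 0" "0 \<le> N t *v ones" "0 \<le> ones v* N t" if "t > 0" for t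
    using bi_potential_iff[OF N(1)[OF that]] bp[OF that] by auto
  have right: "((\<lambda>t. t *\<^sub>R (N t *v y)) \<longlongrightarrow> M *v y) at_top" for y
  proof (rule resolvent_tendsto[OF M(2)])
    fix t :: real
    assume "t > 0"
    then have "(mat 1 + t *\<^sub>R V) *v (N t *v y) = y"
      by (simp add: matrix_vector_mul_assoc N)
    then have "t *\<^sub>R ((mat 1 + t *\<^sub>R V) *v (N t *v y)) = t *\<^sub>R y"
      by simp
    then show "t *\<^sub>R (N t *v y) + t *\<^sub>R (V *v (t *\<^sub>R (N t *v y))) = t *\<^sub>R y"
      by (simp add: matrix_vector_mult_add_rdistrib scaleR_add_right matrix_vector_mult_scaleR
          flip: scaleR_matrix_vector_assoc)
  qed
  have left: "((\<lambda>t. t *\<^sub>R (y v* N t)) \<longlongrightarrow> y v* M) at_top" for y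
  proof -
    have "transpose M ** transpose V = mat 1"
      by (metis M(1) matrix_transpose_mul transpose_mat)
    then have "((\<lambda>t. t *\<^sub>R (y v* N t)) \<longlongrightarrow> transpose M *v y) at_top"
    proof (rule resolvent_tendsto)
      fix t :: real
      assume "t > 0"
      then have "(y v* N t) v* (mat 1 + t *\<^sub>R V) = y"
        by (simp add: vector_matrix_mul_assoc N)
      then have "t *\<^sub>R ((y v* N t) v* (mat 1 + t *\<^sub>R V)) = t *\<^sub>R y"
        by simp
      then show "t *\<^sub>R (y v* N t) + t *\<^sub>R (transpose V *v (t *\<^sub>R (y v* N t))) = t *\<^sub>R y"
        by (simp add: vector_matrix_mult_add_rdistrib scaleR_add_right vector_scaleR_matrix_ac
          scaleR_vector_matrix_assoc)
    qed
    then show ?thesis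
      by simp
  qed
  \<comment> \<open>Multiplying by \<open>t > 0\<close> keeps the signs of \<open>N t\<close>, and
    weak inequalities between entries survive the limit.\<close>
  have comp: "0 \<le> z $ i" if "(g \<longlongrightarrow> z) at_top" "\<And>t. t > 0 \<Longrightarrow> 0 \<le> g t $ i"
    for g :: "real \<Rightarrow> real^'n" and z i
    using tendsto_vec_nth[OF that(1), of i]
    by (rule tendsto_lowerbound)
      (auto intro: eventually_mono[OF eventually_gt_at_top[of 0]] that(2))
  show ?thesis
    unfolding bi_potential_iff[OF M(1)]
  proof (intro conjI allI impI V(1))
    fix i j :: 'n
    assume "i \<noteq> j"
    have "0 \<le> (- (M *v axis j 1)) $ i"
      by (rule comp[OF tendsto_minus[OF right[of "axis j 1"]]])
        (use N'(1)[OF _ \<open>i \<noteq> j\<close>] in \<open>auto simp: matrix_vector_mult_basis column_def mult_le_0_iff\<close>)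
    then show "M $ i $ j \<le> 0"
      by (simp add: matrix_vector_mult_basis column_def)
  next
    show "0 \<le> M *v ones"
      using N'(2) by (auto simp: less_eq_vec_def intro!: comp[OF right])
    show "0 \<le> ones v* M"
      using N'(3) by (auto simp: less_eq_vec_def intro!: comp[OF left])
  qed
qed

subsection \<open>Increasing convex functions of a bi-potential\<close>

text \<open>Jensen's inequality, after solving \<open>bal\<close> for \<open>u i\<close>. In the
  application \<open>m\<close> is row \<open>i\<close> of the inverse of \<open>U\<close> and
  \<open>u\<close> is a column \<open>j\<close> of \<open>U\<close> with \<open>j\<close> distinct
  from \<open>i\<close>, so that \<open>bal\<close> is a vanishing entry of the identity
  matrix.\<close>

lemma convex_on_balanced_sum:
  fixes g :: "real \<Rightarrow> real" and m u :: "'n::finite \<Rightarrow> real"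
  assumes g: "convex_on {0..} g" "g 0 = 0"
    and u: "\<And>l. 0 \<le> u l"
    and m: "\<And>l. l \<noteq> i \<Longrightarrow> m l \<le> 0" "0 < m i" "0 \<le> sum m UNIV"
    and bal: "(\<Sum>l\<in>UNIV. m l * u l) = 0"
  shows "(\<Sum>l\<in>UNIV. m l * g (u l)) \<le> 0"
proof -
  text \<open>The weight that is missing from \<open>1\<close> goes to the index \<open>i\<close>, moved to the point \<open>0\<close>.\<close>
  define a where "a l = (if l = i then sum m UNIV / m i else - m l / m i)" for l
  define y where "y l = (if l = i then 0 else u l)" for l
  have split: "sum h UNIV = h i + sum h (UNIV - {i})" for h :: "'n \<Rightarrow> real"
    by (simp add: sum.remove)
  have rest: "sum (\<lambda>l. a l * h l) (UNIV - {i}) = - (sum (\<lambda>l. m l * h l) (UNIV - {i})) / m i" for h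
    by (simp add: a_def sum_divide_distrib flip: sum_negf)
  have "g (\<Sum>l\<in>UNIV. a l *\<^sub>R y l) \<le> (\<Sum>l\<in>UNIV. a l * g (y l))"
  proof (rule convex_on_sum[OF _ _ g(1)])
    have "sum a UNIV = sum m UNIV / m i - sum m (UNIV - {i}) / m i"
      using rest[of "\<lambda>_. 1"] by (simp add: split[of a] a_def[of i])
    also have "\<dots> = 1"
      using m(2) by (simp add: split[of m] field_simps)
    finally show "sum a UNIV = 1" .
    show "0 \<le> a l" for l
      using m by (auto simp: a_def divide_nonpos_pos)
  qed (use u in \<open>auto simp: y_def\<close>)
  moreover have "(\<Sum>l\<in>UNIV. a l *\<^sub>R y l) = u i"
  proof -
    have "(\<Sum>l\<in>UNIV. a l *\<^sub>R y l) = sum (\<lambda>l. a l * u l) (UNIV - {i})"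
      by (simp add: split y_def)
    also have "\<dots> = u i"
      using bal m(2) by (simp add: rest split[of "\<lambda>l. m l * u l"] field_simps)
    finally show ?thesis .
  qed
  moreover have "(\<Sum>l\<in>UNIV. a l * g (y l)) = sum (\<lambda>l. a l * g (u l)) (UNIV - {i})"
    by (simp add: split y_def g(2))
  ultimately have "g (u i) \<le> - (sum (\<lambda>l. m l * g (u l)) (UNIV - {i})) / m i"
    by (simp add: rest)
  then show ?thesis
    using m(2) by (simp add: split[of "\<lambda>l. m l * g (u l)"] field_simps)
qed

text \<open>The parameter \<open>r\<close> covers two cases at once: \<open>r = 0\<close> gives the
  invertibility of the transformed matrix itself, \<open>r = 1\<close> concerns the matrices in the
  definition of class \<T>.\<close>

lemma equilibrium_zero_at_0:
  fixes U :: "real^'n^'n"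
  assumes U: "bi_potential U"
    and g: "strict_mono_on {0..} g" "convex_on {0..} g" "g 0 = 0"
    and rt: "0 \<le> r" "0 < t"
  defines "W \<equiv> r *\<^sub>R mat 1 + t *\<^sub>R map_entries g U"
  shows "invertible W \<and> 0 \<le> matrix_inv W *v ones"
proof -
  obtain M where M: "U ** M = mat 1" "M ** U = mat 1" "\<And>i j. i \<noteq> j \<Longrightarrow> M $ i $ j \<le> 0"
    "0 \<le> M *v ones" "0 \<le> ones v* M" and U0: "\<And>i j. 0 \<le> U $ i $ j"
    using U by (rule bi_potential_obtain) blast
  have "matrix_inv U = M"
    using M(1) by (rule matrix_inv_eq)
  then have diag: "M $ i $ i > 0" and row: "(\<Sum>j\<in>UNIV. M $ i $ j) \<ge> 0" for i
    using U by (auto simp: bi_potential_def)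
  define A where "A = M ** map_entries g U"
  let ?B = "t *\<^sub>R A + r *\<^sub>R M"
  have offA: "A $ i $ j \<le> 0" if "i \<noteq> j" for i j
    unfolding A_def matrix_matrix_mult_def map_entries_def
    using convex_on_balanced_sum[of g "\<lambda>l. U $ l $ j" i "\<lambda>l. M $ i $ l"] g U0 M(3) diag row
      arg_cong[OF M(2), of "\<lambda>A. A $ i $ j"] that
    by (simp add: matrix_matrix_mult_def mat_def)
  \<comment> \<open>Since \<open>?m v* U = ones\<close>, each column \<open>j\<close> has an
    \<open>i\<close> with \<open>?m $ i\<close> and \<open>U $ i $ j\<close> both positive; there
    \<open>g\<close> is positive too, which gives the strict inequality.\<close>
  have colA: "(ones v* A) $ j > 0" for j
  proof -
    let ?m = "ones v* M"
    have "?m v* U = ones"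
      by (simp add: vector_matrix_mul_assoc M)
    then have "(?m v* U) $ j = 1"
      by (simp add: ones_def)
    then have 1: "(\<Sum>i\<in>UNIV. ?m $ i * U $ i $ j) = 1"
      unfolding vector_matrix_mult_def[of ?m U] by (simp add: mult.commute)
    have m: "0 \<le> ?m $ i" for i
      using M(5) by (simp add: less_eq_vec_def)
    have g_pos: "0 < g x" if "0 < x" for x
      using strict_mono_onD[OF g(1), of 0 x] that g(3) by simp
    then have g_nn: "0 \<le> g (U $ i $ j)" for i
      using g(3) U0[of i j] by (metis order_le_less)
    obtain i where "?m $ i * U $ i $ j \<noteq> 0"
      using 1 sum.neutral[of UNIV "\<lambda>i. ?m $ i * U $ i $ j"] by fastforce
    then have "0 < ?m $ i" "0 < U $ i $ j"
      using m[of i] U0[of i j] by (metis mult_eq_0_iff order_le_less)+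
    then have "0 < ?m $ i * g (U $ i $ j)"
      using g_pos by simp
    then have "0 < (\<Sum>i\<in>UNIV. ?m $ i * g (U $ i $ j))"
      using m g_nn by (intro sum_pos2[of UNIV i]) simp_all
    also have "\<dots> = (ones v* A) $ j"
      by (simp add: A_def vector_matrix_mult_def[of ?m] map_entries_def mult.commute
          flip: vector_matrix_mul_assoc)
    finally show ?thesis .
  qed
  have off: "?B $ i $ j \<le> 0" if "i \<noteq> j" for i j
    using offA[OF that] M(3)[OF that] rt
    by (auto intro!: add_nonpos_nonpos mult_nonneg_nonpos)
  have col: "(ones v* ?B) $ j > 0" for j
    using colA[of j] M(5) rt
    by (auto simp: less_eq_vec_def vector_matrix_mult_add_rdistrib vector_scaleR_matrix_ac
        scaleR_vector_matrix_assoc intro!: add_pos_nonneg)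
  obtain C where C: "?B ** C = mat 1" "C ** ?B = mat 1" "\<And>y. 0 \<le> y \<Longrightarrow> 0 \<le> C *v y"
    using Z_matrix_inverse[of ?B, OF off col] by metis
  have "U ** A = map_entries g U"
    by (simp add: A_def matrix_mul_assoc M)
  then have "W = U ** ?B"
    by (simp add: W_def matrix_add_ldistrib matrix_scalar_ac M add.commute flip: scalar_matrix_assoc)
  then have W: "W ** (C ** M) = mat 1"
    by (metis C(1) M(1) matrix_mul_assoc matrix_mul_rid)
  then have "invertible W"
    by (auto simp: invertible_right_inverse)
  moreover have "0 \<le> matrix_inv W *v ones"
    using C(3)[OF M(4)] by (simp add: matrix_inv_eq[OF W] matrix_vector_mul_assoc)
  ultimately show ?thesis
    by simp
qed

text \<open>The constant matrix sends \<open>x\<close> to a multiple of \<open>ones\<close>. Hence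
  \<open>W'\<close> maps \<open>\<rho>\<close>, the solution of \<open>W *v \<rho> = ones\<close>,
  to a positive multiple of \<open>ones\<close>, and the new solution is a rescaling of
  \<open>\<rho>\<close>.\<close>

lemma equilibrium_add_constant:
  fixes W :: "real^'n^'n"
  assumes W: "invertible W" "0 \<le> matrix_inv W *v ones" and c: "0 \<le> c"
  defines "W' \<equiv> W + (\<chi> i j. c)"
  shows "invertible W' \<and> 0 \<le> matrix_inv W' *v ones"
proof -
  obtain M where M: "W ** M = mat 1" "M ** W = mat 1" "matrix_inv W = M"
    using W(1) by (rule invertible_obtain)
  define \<rho> where "\<rho> = M *v ones"
  have \<rho>: "0 \<le> \<rho>" "W *v \<rho> = ones"
    using W(2) by (auto simp: \<rho>_def M matrix_vector_mul_assoc)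
  define s where "s x = sum (($) x) UNIV" for x :: "real^'n"
  have W': "W' *v x = W *v x + (c * s x) *\<^sub>R ones" for x
    by (simp add: W'_def s_def matrix_vector_mult_add_rdistrib)
      (simp add: vec_eq_iff matrix_vector_mult_def ones_def sum_distrib_left)
  have "0 \<le> s \<rho>"
    using \<rho>(1) by (auto simp: s_def less_eq_vec_def intro!: sum_nonneg)
  with c have pos: "0 < 1 + c * s \<rho>"
    by (simp add: add_pos_nonneg)
  have s_scale: "s (a *\<^sub>R x) = a * s x" for a x
    by (simp add: s_def sum_distrib_left)
  \<comment> \<open>A kernel vector is a multiple of \<open>\<rho>\<close> with coefficient
    \<open>- c * s x\<close>; summing its entries forces \<open>s x = 0\<close>.\<close>
  have "x = 0" if "W' *v x = 0" for x
  proof -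
    have "W *v x = (- c * s x) *\<^sub>R ones"
      using that by (simp add: W' eq_neg_iff_add_eq_0)
    then have "M *v (W *v x) = (- c * s x) *\<^sub>R \<rho>"
      by (simp only: \<rho>_def matrix_vector_mult_scaleR)
    then have x: "x = (- c * s x) *\<^sub>R \<rho>"
      by (simp only: matrix_vector_mul_assoc M matrix_vector_mul_lid)
    then have "s x = - c * s x * s \<rho>"
      by (metis s_scale)
    then have "(1 + c * s \<rho>) * s x = 0"
      by (simp add: algebra_simps)
    with pos have "s x = 0"
      by simp
    with x show "x = 0"
      by simp
  qed
  then have inv: "invertible W'"
    by (simp add: invertible_left_inverse matrix_left_invertible_ker)
  then obtain M' where M': "M' ** W' = mat 1" "matrix_inv W' = M'"
    by (rule invertible_obtain)
  have "W' *v \<rho> = (1 + c * s \<rho>) *\<^sub>R ones"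
    by (simp add: W' \<rho> scaleR_add_left)
  then have "W' *v ((1 / (1 + c * s \<rho>)) *\<^sub>R \<rho>) = ones"
    using pos by (simp add: matrix_vector_mult_scaleR)
  then have "M' *v ones = (1 / (1 + c * s \<rho>)) *\<^sub>R \<rho>"
    by (metis M'(1) matrix_vector_mul_assoc matrix_vector_mul_lid)
  with \<rho>(1) pos have "0 \<le> M' *v ones"
    by (auto simp: less_eq_vec_def)
  with inv M' show ?thesis
    by simp
qed

lemma equilibrium_right:
  fixes U :: "real^'n^'n"
  assumes U: "bi_potential U"
    and f: "0 \<le> f 0" "strict_mono_on {0..} f" "convex_on {0..} f"
    and rt: "0 \<le> r" "0 < t"
  defines "W \<equiv> r *\<^sub>R mat 1 + t *\<^sub>R map_entries f U"
  shows "invertible W \<and> 0 \<le> matrix_inv W *v ones"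
proof -
  let ?g = "\<lambda>x. f x - f 0"
  have "strict_mono_on {0..} ?g"
    using f(2) by (auto simp: strict_mono_on_def)
  moreover have "convex_on {0..} ?g"
    using convex_on_add[OF f(3), of "\<lambda>_. - f 0"] by (simp add: convex_on_const)
  ultimately have
    "invertible (r *\<^sub>R mat 1 + t *\<^sub>R map_entries ?g U) \<and>
      0 \<le> matrix_inv (r *\<^sub>R mat 1 + t *\<^sub>R map_entries ?g U) *v ones"
    using U rt by (intro equilibrium_zero_at_0) auto
  moreover have "W = r *\<^sub>R mat 1 + t *\<^sub>R map_entries ?g U + (\<chi> i j. t * f 0)"
    by (simp add: W_def vec_eq_iff map_entries_def algebra_simps)
  ultimately show ?thesis
    using rt f(1) by (auto dest: equilibrium_add_constant[of _ "t * f 0"])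
qed

text \<open>Applying \<open>f\<close> entrywise commutes with transposition, and the transpose of a
  bi-potential is again one, so this is the right-hand version for
  \<open>transpose U\<close>.\<close>

lemma equilibrium_left:
  fixes U :: "real^'n^'n"
  assumes U: "bi_potential U"
    and f: "0 \<le> f 0" "strict_mono_on {0..} f" "convex_on {0..} f"
    and rt: "0 \<le> r" "0 < t"
  defines "W \<equiv> r *\<^sub>R mat 1 + t *\<^sub>R map_entries f U"
  shows "0 \<le> ones v* matrix_inv W"
proof -
  have "r *\<^sub>R mat 1 + t *\<^sub>R map_entries f (transpose U) = transpose W"
    by (simp add: W_def vec_eq_iff map_entries_def transpose_def mat_def)
  then have "0 \<le> matrix_inv (transpose W) *v ones"
    using equilibrium_right[OF bi_potential_transpose[OF U] f rt] by simp
  moreover have "invertible W"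
    unfolding W_def using equilibrium_right[OF U f rt] by blast
  ultimately show ?thesis
    by (simp add: matrix_inv_transpose)
qed

theorem theorem2p5:
  fixes U :: "real^'n^'n" and f :: "real \<Rightarrow> real"
  assumes "bi_potential U"
    and "\<And>x. 0 \<le> x \<Longrightarrow> 0 \<le> f x"
    and "strict_mono_on {0..} f"
    and "convex_on {0..} f"
  shows "bi_potential (map_entries f U) \<longleftrightarrow> class_T (map_entries f U)"
proof -
  let ?V = "map_entries f U"
  have f0: "0 \<le> f 0"
    using assms(2) by simp
  have nonneg: "nonneg_matrix ?V"
    using assms(1,2) by (simp add: bi_potential_def nonneg_matrix_def map_entries_def)
  note right = equilibrium_right[OF assms(1) f0 assms(3,4)]
    and left = equilibrium_left[OF assms(1) f0 assms(3,4)]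
  have inv: "invertible ?V"
    using right[of 0 1] by simp
  have empty: "{ereal t | t. t > 0 \<and> invertible (mat 1 + t *\<^sub>R ?V) \<and>
      ((\<exists>i. (matrix_inv (mat 1 + t *\<^sub>R ?V) *v ones) $ i < 0) \<or>
       (\<exists>j. (ones v* matrix_inv (mat 1 + t *\<^sub>R ?V)) $ j < 0))} = {}"
    using right[of 1] left[of 1] by (auto simp: less_eq_vec_def not_less[symmetric])
  \<comment> \<open>The second infimum is now taken over the empty set, hence equals
    \<infinity>.\<close>
  have "class_T ?V \<longleftrightarrow> tau ?V = \<infinity>"
    using nonneg unfolding class_T_def empty by (auto simp: top_ereal_def)
  also have "\<dots> \<longleftrightarrow> (\<forall>t\<ge>0. bi_potential (mat 1 + t *\<^sub>R ?V))"
    unfolding tau_def top_ereal_def[symmetric] Inf_top_conv by (auto simp: top_ereal_def)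
  also have "\<dots> \<longleftrightarrow> bi_potential ?V"
    using bi_potential_mat1_add[of ?V] bi_potential_limit[OF nonneg inv] by auto
  finally show ?thesis
    by simp
qed

end
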